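(* Let $G$ be a totally disconnected locally compact group, and let $\alpha$ be a topological automorphism of $G$. If $\alpha$ has a dense orbit, then $G$ is compact. Moreover, $\alpha$ is topologically mixing.
   Context: All topological spaces are Hausdorff; $G$ is not assumed metrizable. The automorphism $\alpha$ has a dense orbit if there is $x\in G$ such that $\{\alpha^n(x):n\in\mathbb Z\}$ is dense in $G$. It is topologically mixing if for all non-empty open sets $A,B\subseteq G$ there is $N\ge 0$ such that $\alpha^n(A)\cap B\neq\varnothing$ for all $n\ge N$. The final assertion is also under the hypothesis that $\alpha$ has a dense orbit. *)

theory Defs
  imports "HOL-Analysis.Analysis"
begin

text \<open>
  Topological groups are rendered by the class \<^class>\<open>topological_group_add\<close>. It extends
  \<^class>\<open>group_add\<close>, which is written additively but is not commutative.
\<close>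

definition totally_disconnected :: "'a::topological_space set \<Rightarrow> bool" where
  "totally_disconnected S \<longleftrightarrow> (\<forall>C\<subseteq>S. connected C \<longrightarrow> (\<exists>a. C \<subseteq> {a}))"

definition topological_automorphism :: "('a::topological_group_add \<Rightarrow> 'a) \<Rightarrow> bool" where
  "topological_automorphism \<alpha> \<longleftrightarrow>
     (\<forall>x y. \<alpha> (x + y) = \<alpha> x + \<alpha> y) \<and> homeomorphism UNIV UNIV \<alpha> (inv \<alpha>)"

text \<open>Meaningful for bijective functions only.\<close>

definition int_iterate :: "('a \<Rightarrow> 'a) \<Rightarrow> int \<Rightarrow> 'a \<Rightarrow> 'a" where
  "int_iterate f n = (if n \<ge> 0 then f ^^ nat n else inv f ^^ nat (- n))"

definition has_dense_orbit :: "('a::topological_space \<Rightarrow> 'a) \<Rightarrow> bool" where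
  "has_dense_orbit f \<longleftrightarrow> (\<exists>x. closure (range (\<lambda>n. int_iterate f n x)) = UNIV)"

definition topologically_mixing :: "('a::topological_space \<Rightarrow> 'a) \<Rightarrow> bool" where
  "topologically_mixing f \<longleftrightarrow>
     (\<forall>A B. open A \<and> A \<noteq> {} \<and> open B \<and> B \<noteq> {} \<longrightarrow>
        (\<exists>N::nat. \<forall>n\<ge>N. (f ^^ n) ` A \<inter> B \<noteq> {}))"

end

theory Submission
  imports Defs "HOL-Library.Set_Algebras"
begin

text \<open>
  By compactness every compact open subgroup contains a compact open subgroup \<open>U\<close> with
  \<open>U = U\<^sub>+ + U\<^sub>-\<close>, where \<open>\<alpha>\<close> expands \<open>U\<^sub>+\<close> and contracts \<open>U\<^sub>-\<close> (the first half of Willis'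
  tidying procedure). If \<open>G\<close> is not discrete, a dense orbit makes \<open>\<alpha>\<close> topologically transitive in
  both time directions, and therefore \<open>G = \<Union>\<^bsub>n\<^esub> \<alpha>\<^sup>n(U\<^sub>+) + U = \<Union>\<^bsub>n\<^esub> \<alpha>\<^bsup>-n\<^esup>(U\<^sub>-) + U\<close>. The second
  union covers the compact set \<open>\<alpha>(U\<^sub>+)\<close> at a finite stage, so
  \<open>\<alpha>(U\<^sub>+) \<subseteq> \<alpha>\<^bsup>-N\<^esup>(U\<^sub>-) + U\<^sub>+\<close>. Applying \<open>\<alpha>\<^sup>n\<close> for \<open>n \<ge> N\<close> moves the first summand into
  \<open>U\<^sub>-\<close>, whence \<open>\<alpha>\<^sup>n(U\<^sub>+) \<subseteq> U\<^sub>- + \<alpha>\<^sup>N(U\<^sub>+)\<close> for all \<open>n \<ge> N\<close>, and \<open>G\<close> is the compact set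
  \<open>U\<^sub>- + \<alpha>\<^sup>N(U\<^sub>+) + U\<^sub>-\<close>. Mixing follows from the same covers, because the subgroups \<open>U\<close> form a
  neighbourhood base of the identity.
\<close>

section \<open>Compactness and subgroups in topological groups\<close>

lemma compact_subset_incseq_open:
  fixes A :: "nat \<Rightarrow> 'a::topological_space set"
  assumes "compact K" "incseq A" "\<And>n. open (A n)" "K \<subseteq> (\<Union>n. A n)"
  obtains n where "K \<subseteq> A n"
proof -
  obtain I where I: "finite I" "K \<subseteq> (\<Union>n\<in>I. A n)"
    using compactE_image[OF assms(1), of UNIV A] assms(3,4) by metis
  obtain m where "\<forall>i\<in>I. i \<le> m"
    using \<open>finite I\<close> finite_nat_set_iff_bounded_le by blast
  then have "(\<Union>n\<in>I. A n) \<subseteq> A m"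
    using incseqD[OF \<open>incseq A\<close>] by (intro UN_least) simp
  then show thesis
    using I(2) by (intro that) (rule subset_trans)
qed

text \<open>The complements of the \<open>C n\<close> form an increasing open cover of the compact
  set \<open>K - W\<close>. For \<open>W = {}\<close> this is the finite intersection
  property.\<close>

lemma decseq_closed_subset_open:
  fixes C :: "nat \<Rightarrow> 'a::topological_space set"
  assumes "decseq C" and closed: "\<And>n. closed (C n)"
    and "compact K" "C 0 \<subseteq> K" and "open W" and sub: "(\<Inter>n. C n) \<subseteq> W"
  obtains n where "C n \<subseteq> W"
proof -
  have "incseq (\<lambda>n. - C n)"
    using \<open>decseq C\<close> by (auto simp: incseq_def decseq_def)
  moreover have "K - W \<subseteq> (\<Union>n. - C n)"
    using sub by auto
  ultimately obtain n where n: "K - W \<subseteq> - C n"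
    using compact_subset_incseq_open[OF compact_diff[OF \<open>compact K\<close> \<open>open W\<close>]] closed
    by (metis open_Compl)
  have "C n \<subseteq> K"
    using decseqD[OF \<open>decseq C\<close>, of 0 n] \<open>C 0 \<subseteq> K\<close> by simp
  then have "C n \<subseteq> W"
    using n by blast
  then show thesis ..
qed

lemma compact_set_plus:
  fixes A B :: "'a::topological_monoid_add set"
  assumes "compact A" "compact B"
  shows "compact (A + B)"
proof -
  have "A + B = (\<lambda>p. fst p + snd p) ` (A \<times> B)"
    by (force simp: set_plus_def)
  then show ?thesis
    using assms
    by (auto intro!: compact_continuous_image compact_Times continuous_intros)
qed

lemma open_left_translation_vimage:
  fixes U :: "'a::topological_group_add set"
  assumes "open U"
  shows "open ((+) a -` U)"
  using assms by (intro open_vimage continuous_intros) auto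

lemma open_set_plus:
  fixes A U :: "'a::topological_group_add set"
  assumes "open U"
  shows "open (A + U)"
proof -
  have "A + U = (\<Union>a\<in>A. (+) (- a) -` U)"
    by (force simp: set_plus_def add.assoc[symmetric] intro: exI[of _ "- a + x" for a x])
  then show ?thesis
    using assms by (simp add: open_UN open_left_translation_vimage)
qed

definition add_subgroup :: "'a::group_add set \<Rightarrow> bool" where
  "add_subgroup H \<longleftrightarrow> 0 \<in> H \<and> (\<forall>x\<in>H. \<forall>y\<in>H. x + y \<in> H) \<and> (\<forall>x\<in>H. - x \<in> H)"

lemma add_subgroupD:
  assumes "add_subgroup H"
  shows "0 \<in> H" "x \<in> H \<Longrightarrow> y \<in> H \<Longrightarrow> x + y \<in> H" "x \<in> H \<Longrightarrow> - x \<in> H"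
    "x \<in> H \<Longrightarrow> y \<in> H \<Longrightarrow> x - y \<in> H"
  using assms unfolding add_subgroup_def diff_conv_add_uminus by blast+

text \<open>The complement of a subgroup is a union of left cosets, each a translate of
  \<open>H\<close>.\<close>

lemma add_subgroup_open_imp_closed:
  fixes H :: "'a::topological_group_add set"
  assumes "add_subgroup H" "open H"
  shows "closed H"
proof -
  have "- H = - H + H"
  proof
    show "- H \<subseteq> - H + H"
      using add_subgroupD(1)[OF assms(1)] by (force simp: set_plus_def)
    show "- H + H \<subseteq> - H"
    proof
      fix x assume "x \<in> - H + H"
      then obtain a h where "a \<notin> H" "h \<in> H" "x = a + h"
        by (auto simp: set_plus_def)
      then show "x \<in> - H"
        using add_subgroupD(4)[OF assms(1), of x h] by auto
    qed
  qed
  then show ?thesis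
    using open_set_plus[OF assms(2), of "- H"] by (simp add: closed_def)
qed

section \<open>Van Dantzig's theorem\<close>

text \<open>In a compact Hausdorff space components and quasi-components agree. Hence relatively
  clopen sets separate \<open>x\<close> from each point of \<open>K - (T \<inter> W)\<close>, and by
  compactness from this whole set at once.\<close>

lemma totally_disconnected_compact_open_nhd:
  fixes W :: "'a::t2_space set"
  assumes td: "totally_disconnected (UNIV :: 'a set)"
    and lc: "locally_compact_space (euclidean :: 'a topology)"
    and W: "open W" "x \<in> W"
  obtains V where "compact V" "open V" "x \<in> V" "V \<subseteq> W"
proof -
  obtain T K where T: "open T" "compact K" "x \<in> T" "T \<subseteq> K"
    using lc unfolding locally_compact_space_def by (metis UNIV_I compactin_euclidean_iff open_openin topspace_euclidean)
  define X where "X = top_of_set K"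
  have Haus: "Hausdorff_space X"
    unfolding X_def
  proof (rule Hausdorff_space_subtopology)
    show "Hausdorff_space (euclidean :: 'a topology)"
      unfolding Hausdorff_space_def disjnt_def using hausdorff by simp meson
  qed
  have comp: "compact_space X"
    unfolding X_def using T by (simp add: compact_space_subtopology)
  have xK: "x \<in> K" using T by auto
  have sep: "separated_between X {x} {y}" if "y \<in> K - (T \<inter> W)" for y
  proof -
    have "y \<noteq> x" using that T W by auto
    have "\<not> connected_component_of X x y"
    proof
      assume "connected_component_of X x y"
      then obtain S where "connected S" "x \<in> S" "y \<in> S"
        unfolding connected_component_of_def X_def connectedin_subtopology by auto
      then show False
        using td \<open>y \<noteq> x\<close> unfolding totally_disconnected_def by (metis singletonD subsetD top_greatest)
    qed
    moreover have "quasi_component_of X x = connected_component_of X x"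
      using quasi_eq_connected_components_of[of X] Haus comp
      by (simp add: quasi_eq_connected_components_of_pointwise_alt)
    ultimately show ?thesis
      using that xK by (simp add: separated_between_singletons X_def)
  qed
  have "compact (K - (T \<inter> W))"
    using T W by (intro compact_diff open_Int)
  then have "compactin X (K - (T \<inter> W))"
    unfolding X_def by (auto simp: compactin_subtopology)
  then have "separated_between X {x} (K - (T \<inter> W))"
    using sep xK by (subst separated_between_pointwise_right) (auto simp: X_def)
  then obtain V where V: "openin X V" "closedin X V" "x \<in> V" "V \<inter> (K - (T \<inter> W)) = {}"
    unfolding separated_between by (auto simp: disjnt_def)
  obtain O' where O': "open O'" "V = K \<inter> O'"
    using V(1) unfolding X_def by (auto simp: openin_open)
  \<comment> \<open>So far \<open>V\<close> is open only relative to \<open>K\<close>; since it lies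
    inside the open set \<open>T\<close>, it is open in the whole space.\<close>
  have "V = O' \<inter> (T \<inter> W)"
    using O' V(4) T by auto
  moreover have "compact V"
    using V(2) T unfolding X_def using closedin_compact by blast
  ultimately show thesis
    using that O' T W V(3) by blast
qed

text \<open>The tube lemma gives a neighbourhood \<open>N\<close> of 0 with
  \<open>K + N \<subseteq> K\<close>, so the stabilizer of \<open>K\<close> under right translation
  contains a neighbourhood of 0 and is open.\<close>

theorem van_Dantzig:
  fixes W :: "'g::{topological_group_add, t2_space} set"
  assumes "totally_disconnected (UNIV :: 'g set)"
    and "locally_compact_space (euclidean :: 'g topology)"
    and "open W" "0 \<in> W"
  obtains V where "add_subgroup V" "compact V" "open V" "V \<subseteq> W"
proof -
  obtain K where K: "compact K" "open K" "0 \<in> K" "K \<subseteq> W"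
    using totally_disconnected_compact_open_nhd[OF assms] .
  have "open {p :: 'g \<times> 'g. snd p + fst p \<in> K}"
    using open_vimage[OF \<open>open K\<close>, of "\<lambda>p :: 'g \<times> 'g. snd p + fst p"]
    by (simp add: vimage_def continuous_intros)
  moreover have "{0} \<times> K \<subseteq> {p. snd p + fst p \<in> K}"
    by auto
  ultimately have "\<exists>N. 0 \<in> N \<and> open N \<and> N \<times> K \<subseteq> {p. snd p + fst p \<in> K}"
    by (rule Elementary_Topology.tube_lemma[OF \<open>compact K\<close>])
  then obtain N where N: "open N" "0 \<in> N" "N \<times> K \<subseteq> {p. snd p + fst p \<in> K}"
    by (elim exE conjE)
  \<comment> \<open>the right stabilizer of \<open>K\<close>; it lies in \<open>K\<close> because \<open>0 \<in> K\<close>\<close>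
  define H where "H = {h. \<forall>k. k \<in> K \<longleftrightarrow> k + h \<in> K}"
  have sub: "add_subgroup H"
    unfolding add_subgroup_def
  proof (intro conjI ballI)
    show "0 \<in> H" by (simp add: H_def)
    show "x + y \<in> H" if "x \<in> H" "y \<in> H" for x y
      using that by (simp add: H_def add.assoc[symmetric])
    show "- x \<in> H" if "x \<in> H" for x
      unfolding H_def
    proof clarify
      fix k
      show "k \<in> K \<longleftrightarrow> k + - x \<in> K"
        using that spec[of "\<lambda>k. k \<in> K \<longleftrightarrow> k + x \<in> K" "k - x"] by (simp add: H_def)
    qed
  qed
  \<comment> \<open>Symmetry provides the converse half of the stabilizer condition: translating by
    \<open>- h\<close> brings \<open>k + h\<close> back to \<open>k\<close>.\<close>
  define N' where "N' = N \<inter> uminus -` N"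
  have N': "open N'" "0 \<in> N'"
    unfolding N'_def using N by (auto intro!: open_Int open_vimage continuous_intros)
  have "N' \<subseteq> H"
  proof
    fix h assume h: "h \<in> N'"
    have "k + h \<in> K" if "k \<in> K" for k
      using h N(3) that by (auto simp: N'_def)
    moreover have "k \<in> K" if "k + h \<in> K" for k
    proof -
      have "- h \<in> N" using h by (simp add: N'_def)
      then have "(k + h) + - h \<in> K"
        using N(3) that by fastforce
      then show ?thesis by simp
    qed
    ultimately show "h \<in> H"
      unfolding H_def by (intro CollectI allI iffI)
  qed
  have "H = H + N'"
  proof
    show "H \<subseteq> H + N'"
      using N'(2) by (force simp: set_plus_def)
    show "H + N' \<subseteq> H"
      using \<open>N' \<subseteq> H\<close> add_subgroupD(2)[OF sub] by (auto simp: set_plus_def)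
  qed
  then have "open H"
    using open_set_plus[OF N'(1), of H] by simp
  moreover have "H \<subseteq> K"
  proof
    fix h assume "h \<in> H"
    then have "0 + h \<in> K"
      using K(3) unfolding H_def by blast
    then show "h \<in> K" by simp
  qed
  moreover have "compact H"
    using add_subgroup_open_imp_closed[OF sub \<open>open H\<close>] \<open>compact K\<close> \<open>H \<subseteq> K\<close>
    by (metis compact_Int_closed inf.absorb_iff2)
  ultimately show thesis
    using that sub K(4) by blast
qed

section \<open>Topological transitivity\<close>

text \<open>Only non-negative times count here, whereas the orbit in \<open>has_dense_orbit\<close>
  is two-sided.\<close>

definition topologically_transitive :: "('a::topological_space \<Rightarrow> 'a) \<Rightarrow> bool" where
  "topologically_transitive f \<longleftrightarrow>
     (\<forall>A B. open A \<and> A \<noteq> {} \<and> open B \<and> B \<noteq> {} \<longrightarrow> (\<exists>n::nat. (f ^^ n) ` A \<inter> B \<noteq> {}))"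

lemma int_iterate_Suc:
  assumes "bij f"
  shows "f (int_iterate f i x) = int_iterate f (i + 1) x"
proof (cases "i \<ge> 0")
  case True
  then show ?thesis by (simp add: int_iterate_def nat_add_distrib)
next
  case False
  then obtain n where "i = - int (Suc n)"
    by (metis int_cases not_less of_nat_0_le_iff)
  then show ?thesis
    using bij_inv_eq_iff[OF assms]
    by (cases n) (auto simp: int_iterate_def nat_add_distrib surj_f_inv_f[OF bij_is_surj[OF assms]])
qed

lemma funpow_int_iterate:
  assumes "bij f"
  shows "(f ^^ n) (int_iterate f i x) = int_iterate f (i + int n) x"
  by (induction n) (simp_all add: int_iterate_Suc[OF assms] add_ac)

text \<open>Since each non-empty open set meets the orbit infinitely often, it returns to itself after
  arbitrarily long times; this turns a passage at a negative time into one at a positive time.\<close>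

lemma dense_orbit_imp_transitive:
  fixes f :: "'a::t1_space \<Rightarrow> 'a"
  assumes "bij f" and cont: "\<And>n. continuous_on UNIV (f ^^ n)"
    and dense: "has_dense_orbit f"
    and inf: "\<And>C :: 'a set. open C \<Longrightarrow> C \<noteq> {} \<Longrightarrow> infinite C"
  shows "topologically_transitive f"
  unfolding topologically_transitive_def
proof clarify
  fix A B :: "'a set"
  assume A: "open A" "A \<noteq> {}" and B: "open B" "B \<noteq> {}"
  obtain x where x: "closure (range (\<lambda>n. int_iterate f n x)) = UNIV"
    using dense unfolding has_dense_orbit_def by blast
  let ?x = "\<lambda>n. int_iterate f n x"
  have meets: "\<exists>n. ?x n \<in> C" if "open C" "C \<noteq> {}" for C
    using that open_Int_closure_eq_empty[of C "range ?x"] x by auto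
  have infinite_visits: "infinite {n. ?x n \<in> C}" if C: "open C" "C \<noteq> {}" for C
  proof
    assume "finite {n. ?x n \<in> C}"
    then have fin: "finite (?x ` {n. ?x n \<in> C})" by blast
    \<comment> \<open>Deleting the finitely many orbit points from \<open>C\<close> would leave a
      non-empty open set that the orbit misses.\<close>
    then have "open (C - ?x ` {n. ?x n \<in> C})"
      using C by (intro open_Diff finite_imp_closed)
    moreover have "C - ?x ` {n. ?x n \<in> C} \<noteq> {}"
      using fin inf[OF C] by (metis Diff_eq_empty_iff finite_subset)
    ultimately show False
      using meets by blast
  qed
  obtain i j where ij: "?x i \<in> A" "?x j \<in> B"
    using meets A B by meson
  define m where "m = nat (i - j)"
  show "\<exists>n. (f ^^ n) ` A \<inter> B \<noteq> {}"
  proof (cases "i \<le> j")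
    case True
    then have "(f ^^ nat (j - i)) (?x i) = ?x j"
      by (simp add: funpow_int_iterate[OF \<open>bij f\<close>])
    then have "?x j \<in> (f ^^ nat (j - i)) ` A \<inter> B"
      using ij by (metis IntI image_eqI)
    then show ?thesis by blast
  next
    case False
    then have m: "j + int m = i" by (simp add: m_def)
    define C where "C = B \<inter> (f ^^ m) -` A"
    have "open C"
      unfolding C_def using A B cont by (intro open_Int open_vimage)
    moreover have "?x j \<in> C"
      using ij m by (simp add: C_def funpow_int_iterate[OF \<open>bij f\<close>])
    ultimately have "infinite {n. ?x n \<in> C}"
      using infinite_visits by blast
    then have "\<not> {n. ?x n \<in> C} \<subseteq> {j - int m..j + int m}"
      using finite_subset by blast
    then obtain k where k: "?x k \<in> C" "k < j - int m \<or> k > j + int m"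
      by fastforce
    \<comment> \<open>The earlier of the visits at \<open>j\<close> and \<open>k\<close> serves as
      \<open>p\<close>. From \<open>p\<close> the orbit reaches \<open>A\<close> after
      \<open>m\<close> steps, and the gap leaves time \<open>d \<ge> 0\<close> to reach
      \<open>B\<close> at \<open>q\<close>.\<close>
    obtain p q where pq: "?x p \<in> C" "?x q \<in> C" "p + int m \<le> q"
      using k \<open>?x j \<in> C\<close> by (cases "k < j") (force intro: that)+
    define d where "d = nat (q - p - int m)"
    have "(f ^^ d) (?x (p + int m)) = ?x q"
      using pq by (simp add: funpow_int_iterate[OF \<open>bij f\<close>] d_def)
    moreover have "?x (p + int m) \<in> A"
      using pq by (simp add: C_def funpow_int_iterate[OF \<open>bij f\<close>])
    moreover have "?x q \<in> B"
      using pq by (simp add: C_def)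
    ultimately have "?x q \<in> (f ^^ d) ` A \<inter> B"
      by (metis IntI image_eqI)
    then show ?thesis by blast
  qed
qed

section \<open>Subgroups tidy above\<close>

text \<open>Both parts of the Willis decomposition are cores: \<open>U\<^sub>+ = \<Inter>\<^bsub>n\<ge>0\<^esub> \<alpha>\<^sup>n(U)\<close> is
  the core of the inverse map and \<open>U\<^sub>-\<close> the core of \<open>\<alpha>\<close>; moreover \<open>\<alpha>\<^sup>n(U\<^sub>+)\<close> is the
  \<open>n\<close>-th preimage of the core of the inverse map.\<close>

definition core :: "('a \<Rightarrow> 'a) \<Rightarrow> 'a set \<Rightarrow> 'a set" where
  "core f U = {x. \<forall>n. (f ^^ n) x \<in> U}"

definition core_preimage :: "('a \<Rightarrow> 'a) \<Rightarrow> 'a set \<Rightarrow> nat \<Rightarrow> 'a set" where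
  "core_preimage f U n = {x. (f ^^ n) x \<in> core f U}"

lemma core_subset: "core f U \<subseteq> U"
  unfolding core_def by (auto dest: spec[of _ 0])

lemma core_funpow: "x \<in> core f U \<Longrightarrow> (f ^^ n) x \<in> core f U"
  unfolding core_def by (simp flip: funpow_add[THEN fun_cong, unfolded comp_def])

lemma core_preimage_mono:
  assumes "m \<le> n"
  shows "core_preimage f U m \<subseteq> core_preimage f U n"
proof
  fix x assume "x \<in> core_preimage f U m"
  then have "(f ^^ (n - m)) ((f ^^ m) x) \<in> core f U"
    by (simp add: core_preimage_def core_funpow)
  then show "x \<in> core_preimage f U n"
    using assms by (simp add: core_preimage_def flip: funpow_add[THEN fun_cong, unfolded comp_def])
qed

lemma core_preimage_0 [simp]: "core_preimage f U 0 = core f U"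
  by (simp add: core_preimage_def)

lemma core_subset_core_preimage: "core f U \<subseteq> core_preimage f U n"
  using core_preimage_mono[of 0 n f U] by simp

text \<open>The reverse inclusion holds in every subgroup, so this encodes
  \<open>U = U\<^sub>+ + U\<^sub>-\<close>.\<close>

definition tidy_above ::
  "('a \<Rightarrow> 'a) \<Rightarrow> ('a \<Rightarrow> 'a) \<Rightarrow> 'a::topological_group_add set \<Rightarrow> bool" where
  "tidy_above \<alpha> \<beta> U \<longleftrightarrow>
     add_subgroup U \<and> compact U \<and> open U \<and> U \<subseteq> core \<beta> U + core \<alpha> U"

section \<open>Automorphisms and the cores they define\<close>

text \<open>With the inverse as a parameter, every result can be instantiated with \<alpha> and
  \<beta> exchanged, that is, with time reversed.\<close>

locale topological_group_automorphism =
  fixes \<alpha> \<beta> :: "'g::{topological_group_add, t2_space} \<Rightarrow> 'g"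
  assumes add: "\<alpha> (x + y) = \<alpha> x + \<alpha> y"
    and left_inverse [simp]: "\<beta> (\<alpha> x) = x"
    and right_inverse [simp]: "\<alpha> (\<beta> x) = x"
    and cont: "continuous_on UNIV \<alpha>"
    and cont_inverse: "continuous_on UNIV \<beta>"
begin

lemma inverse_automorphism: "topological_group_automorphism \<beta> \<alpha>"
proof
  show "\<beta> (x + y) = \<beta> x + \<beta> y" for x y
    by (metis add left_inverse right_inverse)
qed (use cont cont_inverse in auto)

lemma funpow_hom: "(\<alpha> ^^ n) (x + y) = (\<alpha> ^^ n) x + (\<alpha> ^^ n) y"
  by (induction n) (simp_all add: add)

lemma funpow_zero [simp]: "(\<alpha> ^^ n) 0 = 0"
  using funpow_hom[of n 0 0] add_left_cancel[of "(\<alpha> ^^ n) 0" 0] by simp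

lemma funpow_uminus: "(\<alpha> ^^ n) (- x) = - (\<alpha> ^^ n) x"
  using funpow_hom[of n x "- x"] minus_unique[of "(\<alpha> ^^ n) x" "(\<alpha> ^^ n) (- x)"] by simp

lemma cont_funpow: "continuous_on UNIV (\<alpha> ^^ n)"
proof (induction n)
  case (Suc n)
  then show ?case
    using continuous_on_compose[of UNIV "\<alpha> ^^ n" \<alpha>] continuous_on_subset[OF cont] by simp
qed (simp add: id_def)

lemma funpow_left_inverse [simp]: "(\<beta> ^^ n) ((\<alpha> ^^ n) x) = x"
proof (induction n arbitrary: x)
  case (Suc n)
  then show ?case by (simp add: funpow_swap1)
qed simp

lemma add_subgroup_core:
  assumes "add_subgroup U"
  shows "add_subgroup (core \<alpha> U)"
  using assms unfolding add_subgroup_def core_def by (auto simp: funpow_hom funpow_uminus)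

lemma add_subgroup_core_preimage:
  assumes "add_subgroup U"
  shows "add_subgroup (core_preimage \<alpha> U n)"
  using add_subgroup_core[OF assms] unfolding add_subgroup_def core_preimage_def
  by (auto simp: funpow_hom funpow_uminus)

lemma closed_core:
  assumes "closed U"
  shows "closed (core \<alpha> U)"
proof -
  have "core \<alpha> U = (\<Inter>n. (\<alpha> ^^ n) -` U)"
    by (auto simp: core_def)
  then show ?thesis
    using assms cont_funpow by (auto intro!: closed_INT closed_vimage)
qed

lemma compact_core:
  assumes "compact U"
  shows "compact (core \<alpha> U)"
  using closed_core[OF compact_imp_closed[OF assms]] assms core_subset
  by (metis compact_Int_closed inf.absorb_iff2)

end

context topological_group_automorphism
begin

interpretation inverse: topological_group_automorphism \<beta> \<alpha>
  by (rule inverse_automorphism)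

lemma compact_core_preimage:
  assumes "compact U"
  shows "compact (core_preimage \<alpha> U n)"
proof -
  have "core_preimage \<alpha> U n = (\<beta> ^^ n) ` core \<alpha> U"
    by (force simp: core_preimage_def intro: funpow_left_inverse[symmetric])
  then show ?thesis
    using compact_core[OF assms] inverse.cont_funpow
    by (metis compact_continuous_image continuous_on_subset top_greatest)
qed

text \<open>In a non-commutative group, negation reverses the order of the summands; decomposing
  \<open>- x\<close> therefore yields the opposite decomposition of \<open>x\<close>.\<close>

lemma tidy_above_inverse:
  assumes "tidy_above \<alpha> \<beta> U"
  shows "tidy_above \<beta> \<alpha> U"
proof -
  have sub: "add_subgroup U" and dec: "U \<subseteq> core \<beta> U + core \<alpha> U"
    using assms by (auto simp: tidy_above_def)
  have "x \<in> core \<alpha> U + core \<beta> U" if "x \<in> U" for x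
  proof -
    obtain a b where ab: "a \<in> core \<beta> U" "b \<in> core \<alpha> U" "- x = a + b"
      using add_subgroupD(3)[OF sub \<open>x \<in> U\<close>] dec by (auto simp: set_plus_def)
    then have x_eq: "x = - b + - a"
      by (metis minus_add minus_minus)
    have "- b \<in> core \<alpha> U" "- a \<in> core \<beta> U"
      using ab add_subgroupD(3)[OF add_subgroup_core[OF sub]]
        add_subgroupD(3)[OF inverse.add_subgroup_core[OF sub]] by auto
    then show ?thesis
      unfolding x_eq by (rule set_plus_intro)
  qed
  then show ?thesis
    using assms by (auto simp: tidy_above_def)
qed

section \<open>Existence of subgroups tidy above\<close>

lemma tidy_above_exists:
  assumes V: "add_subgroup V" "compact V" "open V"
  obtains U where "tidy_above \<alpha> \<beta> U" "U \<subseteq> V"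
proof -
  define Vn where "Vn n = (\<Inter>k\<le>n. (\<beta> ^^ k) -` V)" for n
  have closedV: "closed V" using V(1,3) by (rule add_subgroup_open_imp_closed)
  \<comment> \<open>\<open>Q\<close> is \<open>\<alpha>(V\<^sub>+)\<close>, the intersection of the
    decreasing sets \<open>C n\<close>, which are the images of \<open>Vn n\<close> under \<alpha>.
    As \<open>Q + V\<close> is an open set around \<open>Q\<close>, it contains some
    \<open>C N\<close>; this \<open>N\<close> determines \<open>U\<close>.\<close>
  define Q where "Q = {x. \<beta> x \<in> core \<beta> V}"
  define C where "C n = \<beta> -` Vn n" for n
  have "decseq C"
    unfolding decseq_def C_def Vn_def by fastforce
  moreover have closedVn: "closed (Vn n)" for n
    unfolding Vn_def using inverse.cont_funpow closedV by (auto intro!: closed_INT closed_vimage)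
  then have "closed (C n)" for n
    unfolding C_def using cont_inverse by (auto intro!: closed_vimage)
  moreover have "compact (\<alpha> ` V)"
    using V(2) cont by (metis compact_continuous_image continuous_on_subset top_greatest)
  moreover have "C 0 \<subseteq> \<alpha> ` V"
    unfolding C_def Vn_def by (force intro: right_inverse[symmetric])
  moreover have "open (Q + V)"
    using V(3) by (rule open_set_plus)
  moreover have "(\<Inter>n. C n) \<subseteq> Q + V"
  proof
    fix x assume "x \<in> (\<Inter>n. C n)"
    then have "x \<in> Q"
      unfolding C_def Vn_def Q_def core_def by auto
    then have "x + 0 \<in> Q + V"
      using add_subgroupD(1)[OF V(1)] by blast
    then show "x \<in> Q + V" by simp
  qed
  ultimately obtain N where N: "C N \<subseteq> Q + V"
    using decseq_closed_subset_open by blast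
  define U where "U = Vn N"
  have U_iff: "x \<in> U \<longleftrightarrow> (\<forall>k\<le>N. (\<beta> ^^ k) x \<in> V)" for x
    by (auto simp: U_def Vn_def)
  have subV: "U \<subseteq> V"
    using U_iff by fastforce
  have subU: "add_subgroup U"
    using add_subgroupD[OF V(1)]
    by (simp add: add_subgroup_def U_iff inverse.funpow_hom inverse.funpow_uminus)
  have openU: "open U"
    unfolding U_def Vn_def using inverse.cont_funpow V(3) by (auto intro!: open_INT open_vimage)
  have compactU: "compact U"
    using closedVn[of N] V(2) subV unfolding U_def by (metis compact_Int_closed inf.absorb_iff2)
  have core_eq: "core \<beta> V \<subseteq> core \<beta> U"
    unfolding core_def by (auto simp: U_iff simp flip: funpow_add[THEN fun_cong, unfolded comp_def])
  note sub_core = inverse.add_subgroup_core[OF subU]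
  \<comment> \<open>Split \<open>\<alpha> x = q + v\<close> by the choice of \<open>N\<close> and
    pull back by \<beta>. Then \<open>v\<close> lies in \<open>U\<close>: time 0 is
    \<open>v \<in> V\<close>, and later times are earlier times of
    \<open>b = \<beta> v\<close>.\<close>
  have one_step: "\<exists>a\<in>core \<beta> U. \<exists>b\<in>U. x = a + b \<and> \<alpha> b \<in> U" if x: "x \<in> U" for x
  proof -
    have "\<alpha> x \<in> Q + V"
      using N x by (auto simp: C_def U_def)
    then obtain q v where qv: "\<beta> q \<in> core \<beta> V" "v \<in> V" "\<alpha> x = q + v"
      by (auto simp: set_plus_def Q_def)
    then have x_eq: "x = \<beta> q + \<beta> v"
      by (metis inverse.add left_inverse)
    have q: "\<beta> q \<in> core \<beta> U" using qv core_eq by blast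
    have "\<beta> v = - \<beta> q + x" by (simp add: x_eq add.assoc[symmetric])
    then have b: "\<beta> v \<in> U"
      using q core_subset[of \<beta> U] x add_subgroupD[OF subU] by auto
    have "v \<in> U"
      unfolding U_iff
    proof (intro allI impI)
      fix k assume "k \<le> N"
      show "(\<beta> ^^ k) v \<in> V"
      proof (cases k)
        case 0 then show ?thesis using qv by simp
      next
        case (Suc j)
        then show ?thesis
          using b \<open>k \<le> N\<close> by (simp add: U_iff funpow_swap1)
      qed
    qed
    then show ?thesis using q b x_eq right_inverse by metis
  qed
  \<comment> \<open>Apply the induction hypothesis to \<open>\<alpha> b\<close> and pull its
    correction \<open>a'\<close> back by \<beta>, under which the core is invariant; the new
    correction is \<open>a + \<beta> a'\<close>.\<close>
  have steps: "\<exists>a\<in>core \<beta> U. \<forall>k\<le>m. (\<alpha> ^^ k) (- a + x) \<in> U" if "x \<in> U" for m x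
    using that
  proof (induction m arbitrary: x)
    case 0
    then show ?case
      using add_subgroupD(1)[OF sub_core] by force
  next
    case (Suc m)
    obtain a b where ab: "a \<in> core \<beta> U" "b \<in> U" "x = a + b" "\<alpha> b \<in> U"
      using one_step[OF Suc.prems] by blast
    obtain a' where a': "a' \<in> core \<beta> U" "\<And>k. k \<le> m \<Longrightarrow> (\<alpha> ^^ k) (- a' + \<alpha> b) \<in> U"
      using Suc.IH[OF ab(4)] by blast
    have \<beta>a': "\<beta> a' \<in> core \<beta> U"
      using core_funpow[OF a'(1), of 1] by simp
    have eq: "- (a + \<beta> a') + x = \<beta> (- a' + \<alpha> b)"
      using inverse.funpow_uminus[of 1 a']
      by (simp add: ab(3) inverse.add minus_add add.assoc del: add_uminus_conv_diff)
    have eq': "\<beta> (- a' + \<alpha> b) = - \<beta> a' + b"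
      using inverse.funpow_uminus[of 1 a'] by (simp add: inverse.add)
    have "(\<alpha> ^^ k) (- (a + \<beta> a') + x) \<in> U" if "k \<le> Suc m" for k
    proof (cases k)
      case 0
      have "- \<beta> a' + b \<in> U"
        using \<beta>a' ab core_subset[of \<beta> U] add_subgroupD[OF subU] by auto
      then show ?thesis
        unfolding eq eq' using 0 by simp
    next
      case (Suc j)
      then show ?thesis
        unfolding eq using a'(2)[of j] that by (simp add: funpow_swap1)
    qed
    then show ?case
      using add_subgroupD(2)[OF sub_core ab(1) \<beta>a'] by blast
  qed
  have "x \<in> core \<beta> U + core \<alpha> U" if x: "x \<in> U" for x
  proof -
    \<comment> \<open>\<open>D m\<close> collects the corrections valid up to time \<open>m\<close>.
      These are nested non-empty closed subsets of a compact set, so one correction works for all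
      times.\<close>
    define D where "D m = core \<beta> U \<inter> (\<Inter>k\<le>m. (\<lambda>a. (\<alpha> ^^ k) (- a + x)) -` U)" for m
    have "decseq D"
      unfolding decseq_def D_def by fastforce
    moreover have closedU: "closed U"
      using compactU by (rule compact_imp_closed)
    have "continuous_on UNIV (\<lambda>a. (\<alpha> ^^ k) (- a + x))" for k
      by (rule continuous_on_compose2[OF cont_funpow]) (intro continuous_intros subset_UNIV)+
    then have "closed (D m)" for m
      unfolding D_def using inverse.closed_core[OF closedU] closedU
      by (auto intro!: closed_Int closed_INT closed_vimage)
    moreover have "D 0 \<subseteq> core \<beta> U"
      by (auto simp: D_def)
    moreover have "D m \<noteq> {}" for m
      using steps[OF x, of m] by (auto simp: D_def)
    ultimately have "(\<Inter>m. D m) \<noteq> {}"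
      using decseq_closed_subset_open[of D "core \<beta> U" "{}"] inverse.compact_core[OF compactU]
      by auto
    then obtain a where a: "a \<in> (\<Inter>m. D m)" by blast
    then have "a \<in> core \<beta> U" "- a + x \<in> core \<alpha> U"
      by (auto simp: D_def core_def)
    then have "a + (- a + x) \<in> core \<beta> U + core \<alpha> U" by blast
    then show ?thesis by (simp add: add.assoc[symmetric])
  qed
  then have "tidy_above \<alpha> \<beta> U"
    unfolding tidy_above_def using subU compactU openU by blast
  then show thesis using that subV by blast
qed

section \<open>Covers obtained from transitivity\<close>

lemma transitive_inverse:
  assumes "topologically_transitive \<alpha>"
  shows "topologically_transitive \<beta>"
  unfolding topologically_transitive_def
proof clarify
  fix A B :: "'g set" assume "open A" "A \<noteq> {}" "open B" "B \<noteq> {}"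
  then obtain n where "(\<alpha> ^^ n) ` B \<inter> A \<noteq> {}"
    using assms unfolding topologically_transitive_def by meson
  then obtain b where "b \<in> B" "(\<alpha> ^^ n) b \<in> A" by blast
  then have "b \<in> (\<beta> ^^ n) ` A \<inter> B"
    by (auto intro: image_eqI funpow_left_inverse[symmetric])
  then show "\<exists>n. (\<beta> ^^ n) ` A \<inter> B \<noteq> {}" by blast
qed

text \<open>Transitivity takes some \<open>u \<in> U\<close> into \<open>g + U\<close> at a time
  \<open>n\<close>. Writing \<open>u = a + b\<close> along the decomposition, \<open>b\<close> stays
  in \<open>U\<close> under iteration, so \<open>g\<close> differs from
  \<open>(\<alpha> ^^ n) a\<close> only by an element of \<open>U\<close> on the right.\<close>

lemma transitive_cover:
  assumes tidy: "tidy_above \<alpha> \<beta> U" and trans: "topologically_transitive \<alpha>" and K: "compact K"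
  obtains N where "K \<subseteq> core_preimage \<beta> U N + U"
proof -
  have sub: "add_subgroup U" and "open U" and dec: "U \<subseteq> core \<beta> U + core \<alpha> U"
    using tidy by (auto simp: tidy_above_def)
  have "\<exists>n. g \<in> core_preimage \<beta> U n + U" for g
  proof -
    have "open ((+) (- g) -` U)" "g \<in> (+) (- g) -` U"
      using open_left_translation_vimage[OF \<open>open U\<close>] add_subgroupD(1)[OF sub] by auto
    then obtain n u where u: "u \<in> U" "- g + (\<alpha> ^^ n) u \<in> U"
      using trans \<open>open U\<close> add_subgroupD(1)[OF sub] unfolding topologically_transitive_def
      by (metis (no_types, lifting) disjoint_iff empty_iff image_iff vimage_eq)
    obtain a b where ab: "a \<in> core \<beta> U" "b \<in> core \<alpha> U" "u = a + b"
      using u dec by (auto simp: set_plus_def)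
    define c where "c = (\<alpha> ^^ n) b - (- g + (\<alpha> ^^ n) u)"
    have "(\<alpha> ^^ n) b \<in> U"
      using subsetD[OF core_subset core_funpow[OF ab(2)]] .
    then have "c \<in> U"
      unfolding c_def using u(2) by (rule add_subgroupD(4)[OF sub])
    moreover have "(\<alpha> ^^ n) a \<in> core_preimage \<beta> U n"
      using ab(1) by (simp add: core_preimage_def)
    moreover have "(\<alpha> ^^ n) a + c = g"
    proof -
      have "(\<alpha> ^^ n) a + c = ((\<alpha> ^^ n) a + (\<alpha> ^^ n) b) - (- g + (\<alpha> ^^ n) u)"
        by (simp add: c_def add_diff_eq)
      also have "\<dots> = g"
        by (simp add: ab(3) funpow_hom diff_conv_add_uminus minus_add add.assoc del: add_uminus_conv_diff)
      finally show ?thesis .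
    qed
    ultimately show ?thesis by (metis set_plus_intro)
  qed
  then have "K \<subseteq> (\<Union>n. core_preimage \<beta> U n + U)" by blast
  moreover have "incseq (\<lambda>n. core_preimage \<beta> U n + U)"
    unfolding incseq_def by (intro allI impI set_plus_mono2 core_preimage_mono order.refl)
  ultimately show thesis
    using compact_subset_incseq_open[OF K] open_set_plus[OF \<open>open U\<close>] that by meson
qed

end

section \<open>Compactness and mixing from transitivity\<close>

context topological_group_automorphism
begin

interpretation inverse: topological_group_automorphism \<beta> \<alpha>
  by (rule inverse_automorphism)

theorem transitive_imp_compact:
  assumes tidy: "tidy_above \<alpha> \<beta> U" and trans: "topologically_transitive \<alpha>"
  shows "compact (UNIV :: 'g set)"
proof -
  let ?P = "core_preimage \<beta> U" and ?M = "core_preimage \<alpha> U"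
  have sub: "add_subgroup U" and "compact U" and dec: "U \<subseteq> core \<beta> U + core \<alpha> U"
    and dec': "U \<subseteq> core \<alpha> U + core \<beta> U"
    using tidy tidy_above_inverse[OF tidy] by (auto simp: tidy_above_def)
  have "compact (?P 1)"
    using \<open>compact U\<close> by (rule inverse.compact_core_preimage)
  then obtain N where N: "?P 1 \<subseteq> ?M N + U"
    using inverse.transitive_cover[OF tidy_above_inverse[OF tidy] transitive_inverse[OF trans]]
    by blast
  \<comment> \<open>The \<open>U\<^sub>-\<close> part of the remainder is absorbed by the subgroup
    \<open>?M N\<close>, which contains \<open>core \<alpha> U\<close>.\<close>
  have P1: "\<exists>m\<in>?M N. \<exists>c\<in>core \<beta> U. x = m + c" if x: "x \<in> ?P 1" for x
  proof -
    obtain m u where m: "m \<in> ?M N" "u \<in> U" "x = m + u"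
      using N x by (auto simp: set_plus_def)
    obtain a b where ab: "a \<in> core \<alpha> U" "b \<in> core \<beta> U" "u = a + b"
      using m(2) dec' by (auto simp: set_plus_def)
    have "m + a \<in> ?M N"
      using m(1) subsetD[OF core_subset_core_preimage ab(1)]
      by (rule add_subgroupD(2)[OF add_subgroup_core_preimage[OF sub]])
    then show ?thesis
      using ab m by (metis add.assoc)
  qed
  \<comment> \<open>Pull back to \<open>?P 1\<close>, split there, and push forward again;
    \<open>n \<ge> N\<close> guarantees that the first summand has entered
    \<open>core \<alpha> U\<close>.\<close>
  have step: "?P (Suc n) \<subseteq> core \<alpha> U + ?P n" if "n \<ge> N" for n
  proof
    fix x assume "x \<in> ?P (Suc n)"
    then have "(\<beta> ^^ n) x \<in> ?P 1" by (simp add: core_preimage_def)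
    then obtain m c where mc: "m \<in> ?M N" "c \<in> core \<beta> U" "(\<beta> ^^ n) x = m + c"
      using P1 by blast
    have "x = (\<alpha> ^^ n) m + (\<alpha> ^^ n) c"
      using mc(3) by (metis funpow_hom inverse.funpow_left_inverse)
    moreover have "(\<alpha> ^^ n) m \<in> core \<alpha> U"
      using subsetD[OF core_preimage_mono[OF that] mc(1)] by (simp add: core_preimage_def)
    moreover have "(\<alpha> ^^ n) c \<in> ?P n"
      using mc(2) by (simp add: core_preimage_def)
    ultimately show "x \<in> core \<alpha> U + ?P n" by blast
  qed
  have core_add: "core \<alpha> U + core \<alpha> U \<subseteq> core \<alpha> U"
    using add_subgroupD(2)[OF add_subgroup_core[OF sub]] by (auto simp: set_plus_def)
  \<comment> \<open>The summands \<open>core \<alpha> U\<close> collected on the left merge into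
    one, so the bound does not depend on \<open>k\<close>.\<close>
  have bound: "?P (N + k) \<subseteq> core \<alpha> U + ?P N" for k
  proof (induction k)
    case 0
    have "{0} + ?P N \<subseteq> core \<alpha> U + ?P N"
      using add_subgroupD(1)[OF add_subgroup_core[OF sub]] by (intro set_plus_mono2) auto
    then show ?case by (simp flip: set_zero)
  next
    case (Suc k)
    have "?P (N + Suc k) \<subseteq> core \<alpha> U + ?P (N + k)"
      using step[of "N + k"] by simp
    also have "\<dots> \<subseteq> core \<alpha> U + (core \<alpha> U + ?P N)"
      by (intro set_plus_mono2 Suc.IH order.refl)
    also have "\<dots> = (core \<alpha> U + core \<alpha> U) + ?P N"
      by (simp add: add.assoc)
    also have "\<dots> \<subseteq> core \<alpha> U + ?P N"
      by (intro set_plus_mono2 core_add order.refl)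
    finally show ?case .
  qed
  have "g \<in> core \<alpha> U + ?P N + core \<alpha> U" for g
  proof -
    obtain n where "{g} \<subseteq> ?P n + U"
      using transitive_cover[OF tidy trans, of "{g}"] by auto
    then obtain p u where pu: "p \<in> ?P n" "u \<in> U" "g = p + u"
      by (auto simp: set_plus_def)
    obtain a b where ab: "a \<in> core \<beta> U" "b \<in> core \<alpha> U" "u = a + b"
      using pu(2) dec by (auto simp: set_plus_def)
    have "p + a \<in> ?P (N + n)"
      using subsetD[OF core_preimage_mono pu(1)] subsetD[OF core_subset_core_preimage ab(1)]
      by (intro add_subgroupD(2)[OF inverse.add_subgroup_core_preimage[OF sub]]) auto
    then have "(p + a) + b \<in> core \<alpha> U + ?P N + core \<alpha> U"
      using bound ab(2) by blast
    then show ?thesis by (simp add: pu ab add.assoc)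
  qed
  then have "UNIV = core \<alpha> U + ?P N + core \<alpha> U" by blast
  moreover have "compact (core \<alpha> U + ?P N + core \<alpha> U)"
    using \<open>compact U\<close> by (intro compact_set_plus compact_core inverse.compact_core_preimage)
  ultimately show ?thesis by metis
qed

text \<open>The backward cover replaces \<open>h\<close> by a point \<open>v\<close> of the same
  coset with \<open>(\<alpha> ^^ n) v\<close> in \<open>core \<alpha> U\<close> for large
  \<open>n\<close>. The forward cover then supplies a correction \<open>q \<in> U\<close> such that
  \<open>v + q\<close> arrives in \<open>g + U\<close> at time \<open>n\<close>.\<close>

lemma transitive_mixing_cosets:
  assumes tidy: "tidy_above \<alpha> \<beta> U" and trans: "topologically_transitive \<alpha>"
  shows "\<exists>N. \<forall>n\<ge>N. \<exists>x\<in>{h} + U. (\<alpha> ^^ n) x \<in> {g} + U"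
proof -
  let ?P = "core_preimage \<beta> U" and ?M = "core_preimage \<alpha> U"
  have sub: "add_subgroup U" and "compact U"
    using tidy by (auto simp: tidy_above_def)
  obtain k where "{h} \<subseteq> ?M k + U"
    using inverse.transitive_cover[OF tidy_above_inverse[OF tidy] transitive_inverse[OF trans], of "{h}"]
    by auto
  then obtain v u where vu: "v \<in> ?M k" "u \<in> U" "h = v + u"
    by (auto simp: set_plus_def)
  have v_eq: "v = h + - u" by (simp add: vu(3) add.assoc)
  have "compact (core \<alpha> U + {g})"
    using \<open>compact U\<close> by (intro compact_set_plus compact_core) auto
  \<comment> \<open>Covering the whole compact set makes \<open>N\<close> independent of
    \<open>n\<close>, although \<open>- (\<alpha> ^^ n) v + g\<close> varies with
    \<open>n\<close>.\<close>
  then obtain N where N: "core \<alpha> U + {g} \<subseteq> ?P N + U"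
    using transitive_cover[OF tidy trans] by blast
  have "\<exists>x\<in>{h} + U. (\<alpha> ^^ n) x \<in> {g} + U" if n: "n \<ge> max k N" for n
  proof -
    have v: "(\<alpha> ^^ n) v \<in> core \<alpha> U"
      using subsetD[OF core_preimage_mono vu(1), of n] n by (simp add: core_preimage_def)
    then have "- (\<alpha> ^^ n) v + g \<in> core \<alpha> U + {g}"
      using add_subgroupD(3)[OF add_subgroup_core[OF sub]] by blast
    then obtain p w where pw: "p \<in> ?P N" "w \<in> U" "- (\<alpha> ^^ n) v + g = p + w"
      using N by (auto simp: set_plus_def)
    define q where "q = (\<beta> ^^ n) p"
    have "q \<in> U"
      using subsetD[OF core_preimage_mono pw(1), of n] n core_subset[of \<beta> U]
      by (auto simp: core_preimage_def q_def)
    have "(\<alpha> ^^ n) (v + q) = (\<alpha> ^^ n) v + p"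
      by (simp add: funpow_hom q_def)
    also have "\<dots> = g + - w"
    proof -
      have "p = - (\<alpha> ^^ n) v + g + - w"
        by (simp add: pw(3) add.assoc)
      then show ?thesis by (simp add: add.assoc[symmetric] del: add_uminus_conv_diff)
    qed
    finally have "(\<alpha> ^^ n) (v + q) \<in> {g} + U"
      using add_subgroupD(3)[OF sub pw(2)] by (simp only:) (intro set_plus_intro singletonI)
    moreover have "v + q \<in> {h} + U"
    proof -
      have "v + q = h + (- u + q)" by (simp only: v_eq add.assoc)
      then show ?thesis
        using add_subgroupD(2)[OF sub add_subgroupD(3)[OF sub vu(2)] \<open>q \<in> U\<close>] by auto
    qed
    ultimately show ?thesis by blast
  qed
  then show ?thesis by blast
qed

lemma tidy_above_neighbourhood:
  assumes td: "totally_disconnected (UNIV :: 'g set)"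
    and lc: "locally_compact_space (euclidean :: 'g topology)"
    and "open W" "0 \<in> W"
  obtains U where "tidy_above \<alpha> \<beta> U" "U \<subseteq> W"
  using van_Dantzig[OF assms] tidy_above_exists by (metis order.trans)

theorem transitive_imp_mixing:
  assumes td: "totally_disconnected (UNIV :: 'g set)"
    and lc: "locally_compact_space (euclidean :: 'g topology)"
    and trans: "topologically_transitive \<alpha>"
  shows "topologically_mixing \<alpha>"
  unfolding topologically_mixing_def
proof clarify
  fix A B :: "'g set" assume A: "open A" "A \<noteq> {}" and B: "open B" "B \<noteq> {}"
  then obtain h g where hg: "h \<in> A" "g \<in> B" by blast
  have "open ((+) h -` A \<inter> (+) g -` B)" "0 \<in> (+) h -` A \<inter> (+) g -` B"
    using A B hg by (auto intro!: open_Int open_left_translation_vimage)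
  then obtain U where U: "tidy_above \<alpha> \<beta> U" "U \<subseteq> (+) h -` A \<inter> (+) g -` B"
    using tidy_above_neighbourhood[OF td lc] by blast
  have "{h} + U \<subseteq> A" "{g} + U \<subseteq> B"
    using U(2) by (auto simp: set_plus_def)
  then show "\<exists>N. \<forall>n\<ge>N. (\<alpha> ^^ n) ` A \<inter> B \<noteq> {}"
    using transitive_mixing_cosets[OF U(1) trans, of h g] by blast
qed

end

section \<open>The discrete case and the conclusion\<close>

text \<open>A finite non-empty open set has an isolated point, so by translation the group is
  discrete and the dense orbit is everything. It passes through the fixed point 0 and hence is
  \<open>{0}\<close>.\<close>

lemma finite_open_dense_orbit_trivial:
  fixes \<alpha> :: "'g::{topological_group_add, t2_space} \<Rightarrow> 'g"
  assumes "bij \<alpha>" and zero: "\<alpha> 0 = 0" and dense: "has_dense_orbit \<alpha>"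
    and C: "open C" "C \<noteq> {}" "finite (C :: 'g set)"
  shows "(UNIV :: 'g set) = {0}"
proof -
  obtain c where "c \<in> C" using C by blast
  have "open (C - (C - {c}))"
    using C by (intro open_Diff finite_imp_closed) auto
  then have "open {c}"
    using \<open>c \<in> C\<close> by (simp add: Diff_Diff_Int)
  moreover have "{0} = (+) c -` {c}"
    using add_left_cancel[of c _ 0] by auto
  ultimately have zero_open: "open {0 :: 'g}"
    using open_left_translation_vimage by metis
  have sing: "open {g}" for g :: 'g
    using open_set_plus[OF zero_open, of "{g}"] by (simp add: set_plus_def)
  obtain x where "closure (range (\<lambda>n. int_iterate \<alpha> n x)) = UNIV"
    using dense unfolding has_dense_orbit_def by blast
  then have orbit: "\<exists>n. g = int_iterate \<alpha> n x" for g
    using open_Int_closure_eq_empty[OF sing, of g "range (\<lambda>n. int_iterate \<alpha> n x)"] by auto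
  have inv_zero: "inv \<alpha> 0 = 0"
    using zero \<open>bij \<alpha>\<close> by (metis bij_inv_eq_iff)
  have fix_pow: "(f ^^ n) 0 = 0" if "f 0 = 0" for f :: "'g \<Rightarrow> 'g" and n
    using that by (induction n) auto
  have pow_zero: "y = 0" if "(f ^^ n) y = 0" "inj f" "f 0 = 0" for f :: "'g \<Rightarrow> 'g" and n y
    using that fix_pow[of f n] by (metis inj_eq inj_fn)
  obtain n where "int_iterate \<alpha> n x = 0"
    using orbit[of 0] by auto
  then have "x = 0"
    using pow_zero[OF _ bij_is_inj[OF \<open>bij \<alpha>\<close>] zero]
      pow_zero[OF _ bij_is_inj[OF bij_imp_bij_inv[OF \<open>bij \<alpha>\<close>]] inv_zero]
    unfolding int_iterate_def by metis
  moreover have "int_iterate \<alpha> n 0 = 0" for n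
    using fix_pow[of \<alpha>, OF zero] fix_pow[of "inv \<alpha>", OF inv_zero]
    by (simp add: int_iterate_def)
  ultimately have "g = 0" for g :: 'g
    using orbit[of g] by metis
  then show ?thesis by auto
qed

theorem corollary3p5:
  fixes \<alpha> :: "'g::{topological_group_add, t2_space} \<Rightarrow> 'g"
  assumes "totally_disconnected (UNIV :: 'g set)"
    and "locally_compact_space (euclidean :: 'g topology)"
    and "topological_automorphism \<alpha>"
    and "has_dense_orbit \<alpha>"
  shows "compact (UNIV :: 'g set) \<and> topologically_mixing \<alpha>"
proof -
  have hom: "\<alpha> (x + y) = \<alpha> x + \<alpha> y" for x y
    using assms(3) by (simp add: topological_automorphism_def)
  have homeo: "homeomorphism UNIV UNIV \<alpha> (inv \<alpha>)"
    using assms(3) by (simp add: topological_automorphism_def)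
  interpret topological_group_automorphism \<alpha> "inv \<alpha>"
    using hom homeo by unfold_locales (auto simp: homeomorphism_def)
  have "bij \<alpha>"
    by (rule o_bij[of "inv \<alpha>"]) (simp_all add: fun_eq_iff)
  show ?thesis
  \<comment> \<open>Passing from a dense orbit to transitivity relies on infinite open sets;
    otherwise the group is trivial.\<close>
  proof (cases "\<exists>C :: 'g set. open C \<and> C \<noteq> {} \<and> finite C")
    case True
    then have triv: "(UNIV :: 'g set) = {0}"
      using finite_open_dense_orbit_trivial[OF \<open>bij \<alpha>\<close> _ assms(4)] funpow_zero[of 1] by auto
    have "x = y" for x y :: 'g
      using triv by (metis UNIV_I singletonD)
    then have "(\<alpha> ^^ n) ` A \<inter> B \<noteq> {}" if "A \<noteq> {}" "B \<noteq> {}" for n A B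
      using that by (metis disjoint_iff ex_in_conv image_eqI)
    then have "topologically_mixing \<alpha>"
      unfolding topologically_mixing_def by blast
    moreover have "compact (UNIV :: 'g set)"
      unfolding triv by simp
    ultimately show ?thesis by blast
  next
    case False
    then have trans: "topologically_transitive \<alpha>"
      using dense_orbit_imp_transitive[OF \<open>bij \<alpha>\<close> cont_funpow assms(4)] by blast
    obtain U where "tidy_above \<alpha> (inv \<alpha>) U"
      using tidy_above_neighbourhood[OF assms(1,2), of UNIV] by auto
    then show ?thesis
      using transitive_imp_compact trans transitive_imp_mixing[OF assms(1,2)] by blast
  qed
qed

end
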